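(* Let $K$ be a colored regularity graph whose components are $K^{(1)},\ldots,K^{(\ell)}$, and let $p\in(0,1)$. Then $$ \left(g_K(p)\right)^{-1}=\sum_{i=1}^{\ell}\left(g_{K^{(i)}}(p)\right)^{-1}. $$
   Context: A colored regularity graph (CRG) $K$ is a complete graph on a finite vertex set $V(K)$ together with a partition of $V(K)$ into white vertices ${\rm VW}(K)$ and black vertices ${\rm VB}(K)$, and a partition of its edges into white ${\rm EW}(K)$, gray ${\rm EG}(K)$ and black ${\rm EB}(K)$ edges. A sub-CRG is obtained by deleting vertices (remaining vertices and edges keep their colors). For $p\in[0,1]$ and $V(K)=\{v_1,\dots,v_k\}$, ${\bf M}_K(p)$ is the $k\times k$ symmetric matrix whose diagonal entry $(i,i)$ is $p$ if $v_i$ is white and $1-p$ if $v_i$ is black, and whose off-diagonal entry $(i,j)$ is $p$ if $v_iv_j$ is white, $1-p$ if $v_iv_j$ is black, and $0$ if $v_iv_j$ is gray. Define $g_K(p)=\min\{{\bf x}^T{\bf M}_K(p){\bf x}: {\bf x}\in\mathbb{R}^k,\ {\bf x}\geq 0,\ \sum_i x_i=1\}$. A sub-CRG $K'$ of $K$ is a component if every edge $vw$ with $v\in V(K')$, $w\in V(K)\setminus V(K')$ is gray; the components here are the maximal such sub-CRGs that are connected via non-gray edges, partitioning $V(K)$. *)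

theory Defs
  imports "HOL-Analysis.Analysis"
begin

record 'a crg =
  VW :: "'a set"
  VB :: "'a set"
  EW :: "'a set set"
  EG :: "'a set set"
  EB :: "'a set set"

definition verts :: "'a crg \<Rightarrow> 'a set" where
  "verts K = VW K \<union> VB K"

text \<open>Edges are unordered pairs of distinct vertices; the colour classes are allowed to be empty.\<close>

definition is_crg :: "'a crg \<Rightarrow> bool" where
  "is_crg K \<longleftrightarrow>
     finite (verts K) \<and>
     VW K \<inter> VB K = {} \<and>
     EW K \<union> EG K \<union> EB K = {{u, v} |u v. u \<in> verts K \<and> v \<in> verts K \<and> u \<noteq> v} \<and>
     EW K \<inter> EG K = {} \<and> EW K \<inter> EB K = {} \<and> EG K \<inter> EB K = {}"

definition restrict_crg :: "'a crg \<Rightarrow> 'a set \<Rightarrow> 'a crg" where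
  "restrict_crg K S =
     \<lparr>VW = VW K \<inter> S, VB = VB K \<inter> S,
      EW = {e \<in> EW K. e \<subseteq> S}, EG = {e \<in> EG K. e \<subseteq> S}, EB = {e \<in> EB K. e \<subseteq> S}\<rparr>"

definition sub_crg :: "'a crg \<Rightarrow> 'a crg \<Rightarrow> bool" where
  "sub_crg K' K \<longleftrightarrow> (\<exists>S. S \<subseteq> verts K \<and> K' = restrict_crg K S)"

text \<open>The matrix is indexed by the vertices themselves, which avoids choosing an
  enumeration \<open>v\<^sub>1, \<dots>, v\<^sub>k\<close>. It is only meaningful for arguments in \<^term>\<open>verts K\<close>.\<close>

definition crg_matrix :: "'a crg \<Rightarrow> real \<Rightarrow> 'a \<Rightarrow> 'a \<Rightarrow> real" where
  "crg_matrix K p u v =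
     (if u = v then (if u \<in> VW K then p else 1 - p)
      else if {u, v} \<in> EW K then p
      else if {u, v} \<in> EB K then 1 - p
      else 0)"

definition crg_form :: "'a crg \<Rightarrow> real \<Rightarrow> ('a \<Rightarrow> real) \<Rightarrow> real" where
  "crg_form K p x = (\<Sum>u\<in>verts K. \<Sum>v\<in>verts K. x u * crg_matrix K p u v * x v)"

definition weightings :: "'a crg \<Rightarrow> ('a \<Rightarrow> real) set" where
  "weightings K = {x. (\<forall>v\<in>verts K. 0 \<le> x v) \<and> (\<Sum>v\<in>verts K. x v) = 1}"

text \<open>\<open>LEAST\<close> is the minimum of the set of values; it exists by \<open>crg_g_attained\<close> below.\<close>

definition crg_g :: "'a crg \<Rightarrow> real \<Rightarrow> real" where
  "crg_g K p = (LEAST y. y \<in> crg_form K p ` weightings K)"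

definition nongray_adj :: "'a crg \<Rightarrow> ('a \<times> 'a) set" where
  "nongray_adj K = {(u, v). u \<noteq> v \<and> {u, v} \<in> EW K \<union> EB K}"

definition nongray_connected :: "'a crg \<Rightarrow> bool" where
  "nongray_connected K \<longleftrightarrow>
     verts K \<noteq> {} \<and> (\<forall>u\<in>verts K. \<forall>v\<in>verts K. (u, v) \<in> (nongray_adj K)\<^sup>*)"

definition gray_separated :: "'a crg \<Rightarrow> 'a crg \<Rightarrow> bool" where
  "gray_separated K' K \<longleftrightarrow>
     sub_crg K' K \<and> (\<forall>v\<in>verts K'. \<forall>w\<in>verts K - verts K'. {v, w} \<in> EG K)"

definition components_crg :: "'a crg \<Rightarrow> 'a crg set" where
  "components_crg K =
     {K'. gray_separated K' K \<and> nongray_connected K' \<and>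
          \<not> (\<exists>K''. gray_separated K'' K \<and> nongray_connected K'' \<and> verts K' \<subset> verts K'')}"

lemma verts_restrict_crg: "verts (restrict_crg K S) = verts K \<inter> S"
  by (auto simp: verts_def restrict_crg_def)

lemma is_crg_restrict_crg:
  assumes "is_crg K"
  shows "is_crg (restrict_crg K S)"
proof -
  have eq: "EW K \<union> EG K \<union> EB K = {{u, v} |u v. u \<in> verts K \<and> v \<in> verts K \<and> u \<noteq> v}"
    using assms by (simp add: is_crg_def)
  have "{e \<in> EW K. e \<subseteq> S} \<union> {e \<in> EG K. e \<subseteq> S} \<union> {e \<in> EB K. e \<subseteq> S}
      = {e \<in> EW K \<union> EG K \<union> EB K. e \<subseteq> S}"
    by blast
  also have "\<dots> = {{u, v} |u v. u \<in> verts K \<inter> S \<and> v \<in> verts K \<inter> S \<and> u \<noteq> v}"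
    unfolding eq by blast
  finally show ?thesis
    using assms unfolding is_crg_def verts_restrict_crg by (auto simp: restrict_crg_def)
qed

lemma finite_components_crg:
  assumes "is_crg K"
  shows "finite (components_crg K)"
proof (rule finite_subset)
  show "components_crg K \<subseteq> restrict_crg K ` Pow (verts K)"
    by (auto simp: components_crg_def gray_separated_def sub_crg_def)
  show "finite (restrict_crg K ` Pow (verts K))"
    using assms by (simp add: is_crg_def)
qed

lemma crg_g_attained:
  assumes "finite (verts K)" and "verts K \<noteq> {}"
  shows "\<exists>x\<in>weightings K. crg_g K p = crg_form K p x \<and>
           (\<forall>y\<in>weightings K. crg_form K p x \<le> crg_form K p y)"
proof -
  define V where "V = verts K"
  have fin: "finite V" using assms V_def by simp
  define B where "B = PiE UNIV (\<lambda>v. if v \<in> V then {0..1::real} else {0})"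
  define D where "D = B \<inter> {x. (\<Sum>v\<in>V. x v) = 1}"
  have "compact B"
  proof -
    have "compactin (product_topology (\<lambda>i. euclidean) UNIV) B"
      unfolding B_def by (subst compactin_PiE) (auto simp: compactin_euclidean_iff)
    then show ?thesis
      by (simp add: euclidean_product_topology compactin_euclidean_iff)
  qed
  moreover have "closed {x. (\<Sum>v\<in>V. x v) = (1::real)}"
    by (intro closed_Collect_eq continuous_intros continuous_on_product_coordinates)
  ultimately have "compact D" unfolding D_def by (rule compact_Int_closed)
  moreover have "continuous_on D (crg_form K p)"
    unfolding crg_form_def
    by (intro continuous_intros continuous_on_subset[OF continuous_on_product_coordinates]) auto
  moreover have "D \<noteq> {}"
  proof -
    obtain w where "w \<in> V" using assms V_def by blast
    then have "(\<lambda>v. if v = w then 1 else 0) \<in> D"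
      using fin by (auto simp: D_def B_def)
    then show ?thesis by blast
  qed
  ultimately obtain x where x: "x \<in> D" and min: "\<And>y. y \<in> D \<Longrightarrow> crg_form K p x \<le> crg_form K p y"
    using continuous_attains_inf by metis
  have xw: "x \<in> weightings K"
    using x by (auto simp: D_def B_def weightings_def V_def PiE_iff split: if_splits)
  have le: "crg_form K p x \<le> crg_form K p y" if y: "y \<in> weightings K" for y
  proof -
    define z where "z = (\<lambda>v. if v \<in> V then y v else 0)"
    have y0: "\<And>v. v \<in> V \<Longrightarrow> 0 \<le> y v" and y1: "(\<Sum>v\<in>V. y v) = 1"
      using y by (auto simp: weightings_def V_def)
    have "y v \<le> 1" if "v \<in> V" for v
      using member_le_sum[OF that, of y] y0 y1 fin by auto
    then have "z \<in> D"
      using y0 y1 by (auto simp: D_def B_def z_def cong: sum.cong)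
    moreover have "crg_form K p z = crg_form K p y"
      by (simp add: crg_form_def z_def V_def cong: sum.cong)
    ultimately show ?thesis using min by metis
  qed
  have "crg_g K p = crg_form K p x"
    unfolding crg_g_def by (rule Least_equality) (use xw le in auto)
  then show ?thesis using xw le by blast
qed

end

theory Submission
  imports Defs
begin

text \<open>Since the edges between components are gray, the quadratic form splits into the forms of the
  components. If a weighting puts mass \<open>t\<^sub>i\<close> on the \<open>i\<close>-th component then, by homogeneity, the best
  possible value is \<open>\<Sum>\<^sub>i g\<^sub>i t\<^sub>i\<^sup>2\<close>, where \<open>g\<^sub>i > 0\<close> as \<open>0 < p < 1\<close>. By Cauchy--Schwarz the minimum of
  this under \<open>\<Sum>\<^sub>i t\<^sub>i = 1\<close> is \<open>1 / (\<Sum>\<^sub>i 1 / g\<^sub>i)\<close>, attained for \<open>t\<^sub>i\<close> proportional to \<open>1 / g\<^sub>i\<close>.\<close>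

section \<open>Components as classes of non-gray reachability\<close>

text \<open>The reflexive closure relates every element of the type to itself; cutting it down to
  the vertex set yields an equivalence on \<open>verts K\<close>, whose classes will be the vertex
  sets of the components.\<close>

definition nongray_rel :: "'a crg \<Rightarrow> ('a \<times> 'a) set" where
  "nongray_rel K = (nongray_adj K)\<^sup>* \<inter> verts K \<times> verts K"

lemma nongray_adj_verts:
  assumes "is_crg K" and "(u, v) \<in> nongray_adj K"
  shows "u \<in> verts K" and "v \<in> verts K"
proof -
  have "{u, v} \<in> EW K \<union> EG K \<union> EB K"
    using assms(2) by (auto simp: nongray_adj_def)
  also have "\<dots> = {{u, v} |u v. u \<in> verts K \<and> v \<in> verts K \<and> u \<noteq> v}"
    using assms(1) by (simp add: is_crg_def)
  finally show "u \<in> verts K" and "v \<in> verts K"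
    by (auto simp: doubleton_eq_iff)
qed

lemma nongray_adj_not_gray:
  assumes "is_crg K" and "(u, v) \<in> nongray_adj K"
  shows "{u, v} \<notin> EG K"
  using assms by (auto simp: nongray_adj_def is_crg_def)

lemma gray_iff_not_nongray_adj:
  assumes "is_crg K" and "u \<in> verts K" and "v \<in> verts K" and "u \<noteq> v"
  shows "{u, v} \<in> EG K \<longleftrightarrow> (u, v) \<notin> nongray_adj K"
proof -
  have "{u, v} \<in> EW K \<union> EG K \<union> EB K"
    using assms unfolding is_crg_def by blast
  then show ?thesis
    using nongray_adj_not_gray[OF assms(1)] assms(4) by (auto simp: nongray_adj_def)
qed

lemma sym_nongray_adj: "sym (nongray_adj K)"
  by (auto simp: sym_def nongray_adj_def insert_commute)

lemma equiv_nongray_rel: "equiv (verts K) (nongray_rel K)"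
proof (rule equivI)
  show "nongray_rel K \<subseteq> verts K \<times> verts K"
    by (auto simp: nongray_rel_def)
  show "refl_on (verts K) (nongray_rel K)"
    by (auto simp: refl_on_def nongray_rel_def)
  show "sym (nongray_rel K)"
    using sym_rtrancl[OF sym_nongray_adj[of K]] by (auto simp: sym_def nongray_rel_def)
  show "trans (nongray_rel K)"
    by (auto simp: trans_def nongray_rel_def intro: rtrancl_trans)
qed

lemma nongray_adj_restrict_crg:
  "nongray_adj (restrict_crg K S) = nongray_adj K \<inter> S \<times> S"
  by (auto simp: nongray_adj_def restrict_crg_def)

text \<open>A sub-CRG keeps all colors, so it can be recovered from its vertex set; this reduces the
  description of components to one of vertex sets.\<close>

lemma sub_crg_eq_restrict_crg:
  assumes "sub_crg K' K"
  shows "K' = restrict_crg K (verts K')" and "verts K' \<subseteq> verts K"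
  using assms by (auto simp: sub_crg_def verts_restrict_crg inf.absorb2)

text \<open>A non-gray path from \<open>v\<close> cannot leave \<open>K'\<close>, since the leaving
  edge would be gray. Conversely, connecting paths inside \<open>K'\<close> are also paths in
  \<open>K\<close>.\<close>

lemma verts_gray_separated_connected:
  assumes K: "is_crg K" and sep: "gray_separated K' K" and con: "nongray_connected K'"
    and v: "v \<in> verts K'"
  shows "verts K' = nongray_rel K `` {v}"
proof -
  have sub: "sub_crg K' K" using sep by (simp add: gray_separated_def)
  note eq = sub_crg_eq_restrict_crg[OF sub]
  have "w \<in> verts K'" if "(v, w) \<in> (nongray_adj K)\<^sup>*" for w
    using that
  proof (induction rule: rtrancl_induct)
    case (step y z)
    show ?case
    proof (rule ccontr)
      assume "z \<notin> verts K'"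
      then have "{y, z} \<in> EG K"
        using sep step nongray_adj_verts[OF K] by (auto simp: gray_separated_def)
      then show False using nongray_adj_not_gray[OF K] step by blast
    qed
  qed (rule v)
  moreover have "(v, w) \<in> (nongray_adj K)\<^sup>*" if "w \<in> verts K'" for w
  proof -
    have "nongray_adj K' \<subseteq> nongray_adj K"
      by (subst eq(1)) (auto simp: nongray_adj_restrict_crg)
    moreover have "(v, w) \<in> (nongray_adj K')\<^sup>*"
      using con v that by (auto simp: nongray_connected_def)
    ultimately show ?thesis using rtrancl_mono by blast
  qed
  ultimately show ?thesis using eq(2) v by (auto simp: nongray_rel_def)
qed

lemma gray_separated_nongray_class:
  assumes K: "is_crg K" and v: "v \<in> verts K"
  shows "gray_separated (restrict_crg K (nongray_rel K `` {v})) K"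
    and "nongray_connected (restrict_crg K (nongray_rel K `` {v}))"
proof -
  define S where "S = nongray_rel K `` {v}"
  have S: "S \<subseteq> verts K" "v \<in> S" using v by (auto simp: S_def nongray_rel_def)
  have V: "verts (restrict_crg K S) = S" using S by (auto simp: verts_restrict_crg)
  \<comment> \<open>The last step of a nonempty path is an edge, so its end is a vertex of
    \<open>K\<close>; the empty path ends at \<open>v\<close> itself.\<close>
  have in_S: "w \<in> S" if "(v, w) \<in> (nongray_adj K)\<^sup>*" for w
    using that
  proof cases
    case base
    then show ?thesis using S by simp
  next
    case (step y)
    then show ?thesis
      using that v nongray_adj_verts(2)[OF K] by (auto simp: S_def nongray_rel_def)
  qed
  have "{u, w} \<in> EG K" if "u \<in> S" "w \<in> verts K - S" for u w
  proof -
    have "(v, u) \<in> (nongray_adj K)\<^sup>*" using that by (auto simp: S_def nongray_rel_def)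
    then have "(u, w) \<notin> nongray_adj K"
      using in_S that by (meson DiffD2 rtrancl.rtrancl_into_rtrancl)
    then show ?thesis
      using gray_iff_not_nongray_adj[OF K, of u w] that S by auto
  qed
  moreover have "sub_crg (restrict_crg K S) K" using S by (auto simp: sub_crg_def)
  ultimately show "gray_separated (restrict_crg K (nongray_rel K `` {v})) K"
    unfolding gray_separated_def S_def[symmetric] V by blast
  define N where "N = nongray_adj (restrict_crg K S)"
  \<comment> \<open>Every vertex along a path from \<open>v\<close> is itself reachable from
    \<open>v\<close>, hence lies in \<open>S\<close>, so the whole path survives the
    restriction.\<close>
  have path: "(v, w) \<in> N\<^sup>*" if "w \<in> S" for w
  proof -
    have "(v, w) \<in> (nongray_adj K)\<^sup>*" using that by (auto simp: S_def nongray_rel_def)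
    then show ?thesis
    proof (induction rule: rtrancl_induct)
      case (step y z)
      have "y \<in> S" "z \<in> S"
        using in_S step by (blast intro: rtrancl.rtrancl_into_rtrancl)+
      then have "(y, z) \<in> N" using step by (auto simp: N_def nongray_adj_restrict_crg)
      then show ?case using step by (blast intro: rtrancl.rtrancl_into_rtrancl)
    qed simp
  qed
  \<comment> \<open>Two vertices of \<open>S\<close> are joined by going back to \<open>v\<close>
    and out again.\<close>
  have "sym (N\<^sup>*)" unfolding N_def by (intro sym_rtrancl sym_nongray_adj)
  then have "(u, w) \<in> N\<^sup>*" if "u \<in> S" "w \<in> S" for u w
    using path[OF that(1)] path[OF that(2)] by (meson rtrancl_trans symD)
  then show "nongray_connected (restrict_crg K (nongray_rel K `` {v}))"
    unfolding nongray_connected_def S_def[symmetric] V N_def[symmetric] using S by blast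
qed

text \<open>Two gray-separated connected sub-CRGs that share a vertex both have its class as vertex
  set, so neither vertex set lies properly in the other; this gives maximality.\<close>

lemma components_crg_eq:
  assumes K: "is_crg K"
  shows "components_crg K = restrict_crg K ` (verts K // nongray_rel K)"
proof (intro equalityI subsetI)
  fix K' assume "K' \<in> components_crg K"
  then have sep: "gray_separated K' K" and con: "nongray_connected K'"
    by (auto simp: components_crg_def)
  have sub: "sub_crg K' K" using sep by (simp add: gray_separated_def)
  obtain v where v: "v \<in> verts K'" using con by (auto simp: nongray_connected_def)
  then have "verts K' \<in> verts K // nongray_rel K"
    using verts_gray_separated_connected[OF K sep con v] sub_crg_eq_restrict_crg(2)[OF sub]
    by (auto intro: quotientI)
  then show "K' \<in> restrict_crg K ` (verts K // nongray_rel K)"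
    using sub_crg_eq_restrict_crg(1)[OF sub] by blast
next
  fix K' assume "K' \<in> restrict_crg K ` (verts K // nongray_rel K)"
  then obtain v where v: "v \<in> verts K" and K': "K' = restrict_crg K (nongray_rel K `` {v})"
    by (auto elim: quotientE)
  note cls = gray_separated_nongray_class[OF K v, folded K']
  have "v \<in> verts K'" using v by (auto simp: K' verts_restrict_crg nongray_rel_def)
  then have "\<not> verts K' \<subset> verts K''" if "gray_separated K'' K" "nongray_connected K''" for K''
    using verts_gray_separated_connected[OF K] cls that by blast
  then show "K' \<in> components_crg K" using cls by (auto simp: components_crg_def)
qed

section \<open>The quadratic form: restriction, homogeneity, positive minimum\<close>

lemma crg_form_restrict_crg:
  assumes "S \<subseteq> verts K"
  shows "crg_form (restrict_crg K S) p x = (\<Sum>u\<in>S. \<Sum>v\<in>S. x u * crg_matrix K p u v * x v)"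
proof -
  have "crg_matrix (restrict_crg K S) p u v = crg_matrix K p u v" if "u \<in> S" "v \<in> S" for u v
    using that by (simp add: crg_matrix_def restrict_crg_def)
  then show ?thesis
    using assms by (simp add: crg_form_def verts_restrict_crg inf.absorb2)
qed

lemma crg_form_scale: "crg_form K p (\<lambda>v. c * x v) = c\<^sup>2 * crg_form K p x"
  by (simp add: crg_form_def sum_distrib_left power2_eq_square mult_ac)

lemma crg_form_cong:
  "(\<And>v. v \<in> verts K \<Longrightarrow> x v = y v) \<Longrightarrow> crg_form K p x = crg_form K p y"
  by (simp add: crg_form_def)

text \<open>Dividing \<open>x\<close> by its total mass gives a weighting, and the form is
  homogeneous of degree two. This serves vectors whose mass is not 1, such as the part of a
  weighting on one component.\<close>

lemma crg_g_scaled_le: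
  assumes "finite (verts K)" and x: "\<And>v. v \<in> verts K \<Longrightarrow> 0 \<le> x v"
  shows "crg_g K p * (\<Sum>v\<in>verts K. x v)\<^sup>2 \<le> crg_form K p x"
proof (cases "(\<Sum>v\<in>verts K. x v) = 0")
  case True
  then have "x v = 0" if "v \<in> verts K" for v
    using sum_nonneg_eq_0_iff[of "verts K" x] assms that by simp
  then show ?thesis using True by (simp add: crg_form_def)
next
  case False
  define t where "t = (\<Sum>v\<in>verts K. x v)"
  have t: "t > 0" using False sum_nonneg[of "verts K" x] x by (auto simp: t_def)
  have "verts K \<noteq> {}" using False by auto
  moreover have "(\<lambda>v. inverse t * x v) \<in> weightings K"
    using t x by (simp add: weightings_def sum_distrib_left[symmetric] t_def)
  ultimately have "crg_g K p \<le> crg_form K p (\<lambda>v. inverse t * x v)"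
    using crg_g_attained[OF assms(1), of p] by metis
  then have "crg_g K p \<le> crg_form K p x / t\<^sup>2"
    unfolding crg_form_scale by (simp add: field_simps power_inverse)
  then show ?thesis using t by (simp add: t_def[symmetric] field_simps)
qed

text \<open>For \<open>0 < p < 1\<close> no matrix entry is negative and the diagonal is positive,
  so the diagonal term of one vertex of nonzero weight already makes the form positive.\<close>

lemma crg_g_pos:
  assumes "finite (verts K)" and "verts K \<noteq> {}" and p: "0 < p" "p < 1"
  shows "0 < crg_g K p"
proof -
  obtain x where x: "x \<in> weightings K" and g: "crg_g K p = crg_form K p x"
    using crg_g_attained[OF assms(1,2)] by metis
  have x0: "\<And>v. v \<in> verts K \<Longrightarrow> 0 \<le> x v" and x1: "(\<Sum>v\<in>verts K. x v) = 1"
    using x by (auto simp: weightings_def)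
  obtain w where w: "w \<in> verts K" "x w \<noteq> 0"
    using x1 by (metis sum.neutral zero_neq_one)
  have nn: "0 \<le> x u * crg_matrix K p u v * x v" if "u \<in> verts K" "v \<in> verts K" for u v
    using x0 that p by (auto simp: crg_matrix_def)
  have "0 < x w * crg_matrix K p w w * x w"
    using w x0[of w] p by (auto simp: crg_matrix_def)
  also have "\<dots> \<le> (\<Sum>v\<in>verts K. x w * crg_matrix K p w v * x v)"
    using member_le_sum[of w "verts K" "\<lambda>v. x w * crg_matrix K p w v * x v"] w nn assms(1) by auto
  also have "\<dots> \<le> crg_form K p x"
    unfolding crg_form_def
    using member_le_sum[of w "verts K" "\<lambda>u. \<Sum>v\<in>verts K. x u * crg_matrix K p u v * x v"]
      w nn assms(1) by (auto intro: sum_nonneg)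
  finally show ?thesis by (simp add: g)
qed

section \<open>The reciprocal formula for block diagonal matrices\<close>

lemma sum_over_partition:
  assumes "finite A" and "partition_on A P"
  shows "(\<Sum>S\<in>P. \<Sum>v\<in>S. f v) = sum f A"
proof -
  have "sum f A = sum f (\<Union>P)" using assms by (simp add: partition_on_def)
  also have "\<dots> = (\<Sum>S\<in>P. \<Sum>v\<in>S. f v)"
    using assms finite_subset[OF _ assms(1)]
    by (subst sum.Union_disjoint) (auto simp: partition_on_def disjoint_def)
  finally show ?thesis by simp
qed

text \<open>The vanishing entries between blocks make the matrix block diagonal with respect to
  \<open>P\<close>. With \<open>c\<close> the claimed right-hand side, the minimum is bounded by
  \<open>1 / c\<close> from both sides.\<close>

lemma inverse_crg_g_partition:
  assumes fin: "finite (verts K)" and ne: "verts K \<noteq> {}" and p: "0 < p" "p < 1"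
    and P: "partition_on (verts K) P"
    and gray: "\<And>S u v. S \<in> P \<Longrightarrow> u \<in> S \<Longrightarrow> v \<in> verts K - S \<Longrightarrow> crg_matrix K p u v = 0"
  shows "inverse (crg_g K p) = (\<Sum>S\<in>P. inverse (crg_g (restrict_crg K S) p))"
proof -
  define g where "g S = crg_g (restrict_crg K S) p" for S
  define c where "c = (\<Sum>S\<in>P. inverse (g S))"
  have finP: "finite P" using finite_elements[OF fin P] .
  have PV: "S \<subseteq> verts K" if "S \<in> P" for S using P that by (auto simp: partition_on_def)
  have VS: "verts (restrict_crg K S) = S" if "S \<in> P" for S
    using PV[OF that] by (simp add: verts_restrict_crg inf.absorb2)
  have finS: "finite S" if "S \<in> P" for S using PV[OF that] fin finite_subset by blast
  have neS: "S \<noteq> {}" if "S \<in> P" for S using P that by (auto simp: partition_on_def)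
  have gpos: "g S > 0" if "S \<in> P" for S
    unfolding g_def using VS finS neS that p by (intro crg_g_pos) auto
  have "P \<noteq> {}" using P ne by (auto simp: partition_on_def)
  then have cpos: "c > 0" unfolding c_def using gpos finP by (intro sum_pos) auto
  have split: "crg_form K p x = (\<Sum>S\<in>P. crg_form (restrict_crg K S) p x)" for x
  proof -
    \<comment> \<open>For \<open>u\<close> in a block, terms with \<open>v\<close> outside it
      vanish, so the inner sum may run over all vertices or over the block alone.\<close>
    have "(\<Sum>v\<in>verts K. x u * crg_matrix K p u v * x v) = (\<Sum>v\<in>S. x u * crg_matrix K p u v * x v)"
      if "S \<in> P" "u \<in> S" for S u
      using that PV gray by (intro sum.mono_neutral_right fin) auto
    then have "(\<Sum>S\<in>P. crg_form (restrict_crg K S) p x)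
        = (\<Sum>S\<in>P. \<Sum>u\<in>S. \<Sum>v\<in>verts K. x u * crg_matrix K p u v * x v)"
      by (simp add: crg_form_restrict_crg PV)
    then show ?thesis by (simp add: crg_form_def[of K] sum_over_partition[OF fin P])
  qed
  obtain x where x: "x \<in> weightings K" and gx: "crg_g K p = crg_form K p x"
    and xmin: "\<And>y. y \<in> weightings K \<Longrightarrow> crg_g K p \<le> crg_form K p y"
    using crg_g_attained[OF fin ne, of p] by metis
  have lower: "1 / c \<le> crg_g K p"
  proof -
    define t where "t S = (\<Sum>v\<in>S. x v)" for S
    have x0: "\<And>v. v \<in> verts K \<Longrightarrow> 0 \<le> x v" and x1: "(\<Sum>v\<in>verts K. x v) = 1"
      using x by (auto simp: weightings_def)
    have "1 = (\<Sum>S\<in>P. t S)\<^sup>2"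
      by (simp add: t_def sum_over_partition[OF fin P] x1)
    \<comment> \<open>Each \<open>t S\<close> is factored so that in Cauchy-Schwarz the first sum of
      squares becomes the sum of the \<open>g S * (t S)\<^sup>2\<close> and the second becomes
      \<open>c\<close>.\<close>
    also have "\<dots> = (\<Sum>S\<in>P. (sqrt (g S) * t S) * sqrt (inverse (g S)))\<^sup>2"
    proof -
      have "t S = (sqrt (g S) * t S) * sqrt (inverse (g S))" if "S \<in> P" for S
        using gpos[OF that] by (simp add: real_sqrt_inverse)
      then show ?thesis by (metis (mono_tags, lifting) sum.cong)
    qed
    also have "\<dots> \<le> (\<Sum>S\<in>P. (sqrt (g S) * t S)\<^sup>2) * (\<Sum>S\<in>P. (sqrt (inverse (g S)))\<^sup>2)"
      by (rule Cauchy_Schwarz_ineq_sum)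
    also have "\<dots> = (\<Sum>S\<in>P. g S * (t S)\<^sup>2) * c"
      using gpos by (auto simp: c_def power_mult_distrib less_imp_le cong: sum.cong)
    also have "\<dots> \<le> crg_g K p * c"
    proof (rule mult_right_mono)
      have "g S * (t S)\<^sup>2 \<le> crg_form (restrict_crg K S) p x" if "S \<in> P" for S
        using crg_g_scaled_le[of "restrict_crg K S" x p] VS[OF that] finS[OF that] PV[OF that] x0
        by (auto simp: g_def t_def)
      then show "(\<Sum>S\<in>P. g S * (t S)\<^sup>2) \<le> crg_g K p"
        unfolding gx split by (rule sum_mono)
    qed (use cpos in simp)
    finally show ?thesis using cpos by (simp add: field_simps)
  qed
  have upper: "crg_g K p \<le> 1 / c"
  proof -
    have "\<exists>y\<in>weightings (restrict_crg K S). g S = crg_form (restrict_crg K S) p y" if "S \<in> P" for S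
      using crg_g_attained[of "restrict_crg K S" p] VS finS neS that by (auto simp: g_def)
    then obtain y where y: "\<And>S. S \<in> P \<Longrightarrow> y S \<in> weightings (restrict_crg K S)"
      and gy: "\<And>S. S \<in> P \<Longrightarrow> g S = crg_form (restrict_crg K S) p (y S)"
      by metis
    \<comment> \<open>\<open>b v\<close> is the block containing \<open>v\<close>; it is used to
      glue the minimizers \<open>y S\<close> of the blocks into one function.\<close>
    define b where "b v = (THE S. S \<in> P \<and> v \<in> S)" for v
    have b: "b v = S" if "S \<in> P" "v \<in> S" for v S
      unfolding b_def using P that
      by (intro the_equality) (auto simp: partition_on_def disjoint_def)
    \<comment> \<open>Block \<open>S\<close> receives mass \<open>inverse (g S) / c\<close>, spread
      according to its minimizer \<open>y S\<close>; dividing by \<open>c\<close> makes the total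
      mass 1.\<close>
    define z where "z v = inverse (g (b v)) / c * y (b v) v" for v
    have z: "z v = inverse (g S) / c * y S v" if "S \<in> P" "v \<in> S" for v S
      using b[OF that] by (simp add: z_def)
    have "z \<in> weightings K"
    proof -
      have "0 \<le> z v" if "v \<in> verts K" for v
      proof -
        obtain S where S: "S \<in> P" "v \<in> S"
          using \<open>v \<in> verts K\<close> unfolding partition_onD1[OF P] by blast
        then have "0 \<le> y S v" using y VS by (auto simp: weightings_def)
        then show ?thesis using z[OF S] gpos[OF S(1)] cpos by simp
      qed
      moreover have "(\<Sum>v\<in>S. z v) = inverse (g S) / c" if "S \<in> P" for S
      proof -
        have "(\<Sum>v\<in>S. z v) = inverse (g S) / c * (\<Sum>v\<in>S. y S v)"
          by (simp add: z[OF that] sum_distrib_left)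
        then show ?thesis using y[OF that] VS[OF that] by (simp add: weightings_def)
      qed
      then have "(\<Sum>v\<in>verts K. z v) = 1"
        using cpos
        by (simp add: sum_over_partition[OF fin P, symmetric] sum_divide_distrib[symmetric]
            c_def[symmetric])
      ultimately show ?thesis by (simp add: weightings_def)
    qed
    then have "crg_g K p \<le> crg_form K p z" by (rule xmin)
    also have "\<dots> = (\<Sum>S\<in>P. inverse (g S) / c\<^sup>2)"
      unfolding split
    proof (rule sum.cong)
      fix S assume S: "S \<in> P"
      have "crg_form (restrict_crg K S) p z
          = crg_form (restrict_crg K S) p (\<lambda>v. inverse (g S) / c * y S v)"
        by (rule crg_form_cong) (simp add: VS S z[OF S])
      also have "\<dots> = (inverse (g S) / c)\<^sup>2 * g S"
        by (simp only: crg_form_scale gy[OF S, symmetric])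
      also have "\<dots> = inverse (g S) / c\<^sup>2"
        using gpos[OF S] by (simp add: field_simps power2_eq_square)
      finally show "crg_form (restrict_crg K S) p z = inverse (g S) / c\<^sup>2" .
    qed simp
    also have "\<dots> = c / c\<^sup>2" by (simp add: c_def sum_divide_distrib[symmetric])
    also have "\<dots> = 1 / c" by (simp add: power2_eq_square)
    finally show ?thesis .
  qed
  have "crg_g K p = 1 / c" using lower upper by simp
  then show ?thesis by (simp add: c_def g_def inverse_eq_divide)
qed

section \<open>Application to the components\<close>

theorem theorem2p4:
  fixes K :: "'a crg" and Kc :: "nat \<Rightarrow> 'a crg" and l :: nat and p :: real
  assumes "is_crg K" and "verts K \<noteq> {}"
    and "bij_betw Kc {1..l} (components_crg K)"
    and "0 < p" and "p < 1"
  shows "inverse (crg_g K p) = (\<Sum>i=1..l. inverse (crg_g (Kc i) p))"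
proof -
  define P where "P = verts K // nongray_rel K"
  have part: "partition_on (verts K) P"
    unfolding P_def by (rule partition_on_quotient[OF equiv_nongray_rel])
  \<comment> \<open>Classes lie inside \<open>verts K\<close>, so each is the vertex set of its
    restriction.\<close>
  have inj: "inj_on (restrict_crg K) P"
  proof (rule inj_onI)
    fix S T assume "S \<in> P" "T \<in> P" "restrict_crg K S = restrict_crg K T"
    then have "verts K \<inter> S = verts K \<inter> T" by (metis verts_restrict_crg)
    then show "S = T" using part \<open>S \<in> P\<close> \<open>T \<in> P\<close> by (auto simp: partition_on_def)
  qed
  \<comment> \<open>A nonzero entry off the diagonal needs a non-gray edge, and such an edge from
    \<open>u\<close> would put \<open>v\<close> into the class of \<open>u\<close>.\<close>
  have gray: "crg_matrix K p u v = 0" if "S \<in> P" "u \<in> S" "v \<in> verts K - S" for S u v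
  proof -
    obtain w where S: "S = nongray_rel K `` {w}"
      using \<open>S \<in> P\<close> by (auto simp: P_def elim: quotientE)
    then have "(u, v) \<notin> nongray_adj K"
      using that by (auto simp: nongray_rel_def intro: rtrancl.rtrancl_into_rtrancl)
    then show ?thesis using that by (auto simp: crg_matrix_def nongray_adj_def)
  qed
  have "inverse (crg_g K p) = (\<Sum>S\<in>P. inverse (crg_g (restrict_crg K S) p))"
    using assms part gray by (intro inverse_crg_g_partition) (auto simp: is_crg_def)
  also have "\<dots> = (\<Sum>K'\<in>components_crg K. inverse (crg_g K' p))"
    using inj by (simp add: components_crg_eq[OF assms(1)] P_def sum.reindex)
  also have "\<dots> = (\<Sum>i=1..l. inverse (crg_g (Kc i) p))"
    by (rule sum.reindex_bij_betw[OF assms(3), symmetric])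
  finally show ?thesis .
qed

end
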